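(* Let $U$ be a finite set of available items with non-negative prices $p_j$, $j\in U$, and consider a bidder with valuation $v:2^U\to\mathbb{R}_{\ge0}$ and budget $B\ge0$. Let $S\subseteq U$ be the set allocated by the budget-constrained demand query $\mathrm{BCDQ}(v,U,\vec p,B)$. Then for every other $T\subseteq U$: (i) $\bar v(S)\ge\bar v(T)-p(T)$; (ii) $2\bar v(S)-p(S)\ge\bar v(T)-p(T)$.
   Context: Valuations are monotone ($v(S)\le v(T)$ for $S\subseteq T$) and normalized ($v(\emptyset)=0$). $p(S)=\sum_{j\in S}p_j$. The liquid valuation is $\bar v(S)=\min\{v(S),B\}$. $\mathrm{BCDQ}(v,U,\vec p,B)$ returns a set $S\subseteq U$ that maximizes $v(S)-p(S)$ among all subsets of $U$ with $p(S)\le B$. *)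

theory Defs
  imports Complex_Main
begin

text \<open>A valuation on the items \<open>U\<close> is a function \<open>2\<^sup>U \<rightarrow> \<real>\<^sub>\<ge>\<^sub>0\<close>; its values on sets that
  are not contained in \<open>U\<close> are irrelevant and left unconstrained.\<close>

definition valuation :: "'a set \<Rightarrow> ('a set \<Rightarrow> real) \<Rightarrow> bool" where
  "valuation U v \<longleftrightarrow>
     (\<forall>S. S \<subseteq> U \<longrightarrow> 0 \<le> v S) \<and>
     (\<forall>S T. S \<subseteq> T \<and> T \<subseteq> U \<longrightarrow> v S \<le> v T) \<and>
     v {} = 0"

definition liquid :: "('a set \<Rightarrow> real) \<Rightarrow> real \<Rightarrow> 'a set \<Rightarrow> real" where
  "liquid v B S = min (v S) B"

text \<open>The query returns some maximizer, with unspecified tie-breaking. It is modelled by the set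
  of all its admissible answers.\<close>

definition BCDQ :: "('a set \<Rightarrow> real) \<Rightarrow> 'a set \<Rightarrow> ('a \<Rightarrow> real) \<Rightarrow> real \<Rightarrow> 'a set set" where
  "BCDQ v U p B = {S. is_arg_max (\<lambda>S. v S - sum p S) (\<lambda>S. S \<subseteq> U \<and> sum p S \<le> B) S}"

end

theory Submission
  imports Defs
begin

text \<open>Since \<open>S\<close> is affordable and no worse than the empty set, its price is at
  most its liquid value, so both left-hand sides are at least \<open>liquid v B S\<close>, or that
  value minus a price it covers. It remains to bound \<open>liquid v B T - sum p T\<close> by
  \<open>liquid v B S\<close>.\<close>

theorem lemma3p3:
  fixes U :: "'a set" and p :: "'a \<Rightarrow> real" and v :: "'a set \<Rightarrow> real"
    and B :: real and S T :: "'a set"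
  assumes "finite U"
    and "\<And>j. j \<in> U \<Longrightarrow> 0 \<le> p j"
    and "valuation U v"
    and "0 \<le> B"
    and "S \<in> BCDQ v U p B"
    and "T \<subseteq> U"
  shows "liquid v B S \<ge> liquid v B T - sum p T \<and>
    2 * liquid v B S - sum p S \<ge> liquid v B T - sum p T"
proof -
  have opt: "v R - sum p R \<le> v S - sum p S" if "R \<subseteq> U" "sum p R \<le> B" for R
    using assms(5) that by (auto simp: BCDQ_def is_arg_max_linorder)
  have S: "S \<subseteq> U" "sum p S \<le> B"
    using assms(5) by (auto simp: BCDQ_def is_arg_max_linorder)
  have nonneg: "0 \<le> sum p S" "0 \<le> sum p T"
    using S(1) assms(2,6) by (auto intro!: sum_nonneg)
  \<comment> \<open>The empty set is affordable because \<open>0 \<le> B\<close>, and has utility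
    0.\<close>
  have "sum p S \<le> v S"
    using opt[of "{}"] assms(3,4) by (simp add: valuation_def)
  \<comment> \<open>If \<open>T\<close> is unaffordable,
    \<open>liquid v B T \<le> B < sum p T\<close> makes the right-hand side negative; otherwise
    \<open>T\<close> competes with \<open>S\<close>.\<close>
  moreover have "B < sum p T \<or> v T - sum p T \<le> v S - sum p S"
    using opt[OF assms(6)] by linarith
  \<comment> \<open>For affordable \<open>T\<close>: if \<open>v S \<le> B\<close>, optimality
    suffices; if the budget caps \<open>v S\<close>, then
    \<open>liquid v B S = B \<ge> liquid v B T\<close>.\<close>
  ultimately show ?thesis
    using S(2) nonneg unfolding liquid_def min_def by (auto split: if_splits)
qed

end
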